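(* Let $\pi_{\text{tar}}$ and $\pi_{\text{log}}$ be arbitrary policies, $n_{\text{log}}\ge 0$, $n_{\text{aug}}\ge1$, $N=n_{\text{log}}+n_{\text{aug}}$, $\alpha=n_{\text{aug}}/N$. Let $\hat r(x,a)\in\mathbb R$ and $\hat\sigma^2(x,a)>0$ be arbitrary values for all $(x,a)\in\mathcal X\times\mathcal A$ (not necessarily equal to the true conditional mean and variance of the reward). For every $x\in\mathcal X$ let $\pi_{\text{aug}}(\cdot|x)$ be a solution of $$\min_{\pi\in\mathbb R^{|\mathcal A|}}\ \sum_{a\in\mathcal A}\frac{\pi_{\text{tar}}^2(a|x)\,\big(\hat r^2(x,a)+\hat\sigma^2(x,a)\big)}{(1-\alpha)\pi_{\text{log}}(a|x)+\alpha\,\pi(a)}\quad\text{subject to}\quad \sum_{a\in\mathcal A}\pi(a)=1,\ \ \pi(a)\ge 0\ \ \forall a\in\mathcal A .$$ Then the balanced estimator computed from $n_{\text{log}}$ samples logged with $\pi_{\text{log}}$ and $n_{\text{aug}}$ samples logged with $\pi_{\text{aug}}$ is unbiased: $\mathbb E\big[\hat R^{\text{BAL}}_{\pi_{\text{tar}}}\big]=R_{\pi_{\text{tar}}}$.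
   Context: Contextual bandit: $\mathcal X$ is a countable set of contexts with distribution $\Pr(x)$, $\mathcal A$ is a finite action set, a policy $\pi$ assigns to each $x$ a probability distribution $\pi(\cdot|x)$ on $\mathcal A$. For each $(x,a)$ there is a (true) reward distribution; $r(x,a)$ is a random reward drawn from it, with second moment uniformly bounded over $(x,a)$. $R_\pi=\sum_x\sum_a \mathbb E_r[r(x,a)]\,\pi(a|x)\Pr(x)$ is the expected reward of $\pi$. Logged data: $n_{\text{log}}$ independent triples $(x_i,a_i,r_i)$ with $x_i\sim\Pr$, $a_i\sim\pi_{\text{log}}(\cdot|x_i)$, $r_i\sim r(x_i,a_i)$. Augmentation data: $n_{\text{aug}}$ further independent triples with $x_i\sim\Pr$, $a_i\sim\pi_{\text{aug}}(\cdot|x_i)$, $r_i\sim r(x_i,a_i)$. The balanced estimator is $\hat R^{\text{BAL}}_{\pi_{\text{tar}}}=\frac1N\sum_{i}\frac{\pi_{\text{tar}}(a_i|x_i)}{\pi_{\text{balanced}}(a_i|x_i)}r_i$, the sum running over all $N$ triples, where $\pi_{\text{balanced}}(a|x)=(1-\alpha)\pi_{\text{log}}(a|x)+\alpha\pi_{\text{aug}}(a|x)$. Convention in the optimization problem: $0/0=0$ and $c/0=+\infty$ for $c>0$. *)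

theory Defs
  imports "HOL-Probability.Probability"
begin

text \<open>
  The countable context set is a type of class \<open>countable\<close>, the finite action set a type of class
  \<open>finite\<close>. A policy has type \<open>'x \<Rightarrow> 'a pmf\<close>, so that \<open>pmf (p x) a\<close> is $p(a|x)$. The reward
  distribution of \<open>(x, a)\<close> is the measure \<open>D x a\<close> on the reals.
\<close>

definition reward_model :: "('x \<Rightarrow> 'a \<Rightarrow> real measure) \<Rightarrow> bool" where
  "reward_model D \<longleftrightarrow>
     (\<forall>x a. prob_space (D x a) \<and> sets (D x a) = sets borel) \<and>
     (\<exists>B::real. \<forall>x a. (\<integral>\<^sup>+ r. ennreal (r\<^sup>2) \<partial>D x a) \<le> ennreal B)"

definition expected_reward ::
    "'x::countable pmf \<Rightarrow> ('x \<Rightarrow> 'a::finite \<Rightarrow> real measure) \<Rightarrow> ('x \<Rightarrow> 'a pmf) \<Rightarrow> real" where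
  "expected_reward P D p =
     (\<Sum>\<^sub>\<infinity>x\<in>UNIV. \<Sum>a\<in>UNIV. (\<integral>r. r \<partial>D x a) * pmf (p x) a * pmf P x)"

definition triple_space :: "('x::countable \<times> 'a::finite \<times> real) measure" where
  "triple_space = count_space UNIV \<Otimes>\<^sub>M (count_space UNIV \<Otimes>\<^sub>M borel)"

text \<open>Law of one triple \<open>(x, a, r)\<close>: draw \<open>x\<close> from \<open>P\<close>, then \<open>a\<close> from \<open>p x\<close>, then \<open>r\<close> from \<open>D x a\<close>.\<close>

definition sample_law ::
    "'x::countable pmf \<Rightarrow> ('x \<Rightarrow> 'a::finite \<Rightarrow> real measure) \<Rightarrow> ('x \<Rightarrow> 'a pmf)
      \<Rightarrow> ('x \<times> 'a \<times> real) measure" where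
  "sample_law P D p =
     measure_pmf P \<bind> (\<lambda>x. measure_pmf (p x) \<bind>
       (\<lambda>a. distr (D x a) triple_space (\<lambda>r. (x, a, r))))"

definition balanced ::
    "real \<Rightarrow> ('x \<Rightarrow> 'a pmf) \<Rightarrow> ('x \<Rightarrow> 'a pmf) \<Rightarrow> 'x \<Rightarrow> 'a \<Rightarrow> real" where
  "balanced \<alpha> p_log p_aug x a = (1 - \<alpha>) * pmf (p_log x) a + \<alpha> * pmf (p_aug x) a"

text \<open>
  A value \<open>z i = (x, a, r)\<close> with \<open>balanced \<alpha> p_log p_aug x a = 0\<close> contributes 0 here, by
  division in \<open>real\<close>; under the sampling laws considered such triples have probability 0.
\<close>

definition balanced_estimator ::
    "nat \<Rightarrow> real \<Rightarrow> ('x \<Rightarrow> 'a pmf) \<Rightarrow> ('x \<Rightarrow> 'a pmf) \<Rightarrow> ('x \<Rightarrow> 'a pmf)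
      \<Rightarrow> (nat \<Rightarrow> 'x \<times> 'a \<times> real) \<Rightarrow> real" where
  "balanced_estimator N \<alpha> p_tar p_log p_aug z =
     1 / real N *
       (\<Sum>i<N. case z i of (x, a, r) \<Rightarrow> pmf (p_tar x) a / balanced \<alpha> p_log p_aug x a * r)"

definition feasible :: "('a::finite \<Rightarrow> real) \<Rightarrow> bool" where
  "feasible q \<longleftrightarrow> (\<Sum>a\<in>UNIV. q a) = 1 \<and> (\<forall>a. q a \<ge> 0)"

text \<open>
  Division in \<open>ereal\<close> is exactly the convention of the optimization problem, see the
  two lemmas below.
\<close>

definition objective ::
    "real \<Rightarrow> ('x \<Rightarrow> 'a::finite pmf) \<Rightarrow> ('x \<Rightarrow> 'a pmf) \<Rightarrow> ('x \<Rightarrow> 'a \<Rightarrow> real) \<Rightarrow> ('x \<Rightarrow> 'a \<Rightarrow> real)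
      \<Rightarrow> 'x \<Rightarrow> ('a \<Rightarrow> real) \<Rightarrow> ereal" where
  "objective \<alpha> p_tar p_log rhat sigma2hat x q =
     (\<Sum>a\<in>UNIV. ereal ((pmf (p_tar x) a)\<^sup>2 * ((rhat x a)\<^sup>2 + sigma2hat x a))
                / ereal ((1 - \<alpha>) * pmf (p_log x) a + \<alpha> * q a))"

lemma ereal_zero_div_zero: "ereal 0 / ereal 0 = 0"
  by simp

lemma ereal_pos_div_zero: "c > 0 \<Longrightarrow> ereal c / ereal 0 = \<infinity>"
  by (simp add: divide_ereal_def)

end

theory Submission
  imports Defs
begin

text \<open>
  Optimality enters only through supports: \<open>\<alpha> > 0\<close>, so the uniform distribution has a finite
  objective value, hence so does \<open>p_aug x\<close>, and therefore the balanced policy charges every action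
  that \<open>p_tar x\<close> charges. By linearity the expectation of the estimator is the average of the
  weighted rewards under \<open>p_log\<close> and \<open>p_aug\<close> with weights \<open>1 - \<alpha>\<close> and \<open>\<alpha>\<close>; these recombine to the
  balanced policy, which cancels the denominator of the importance weight. The importance weights
  are unbounded, but each sampling probability times its weight is at most \<open>N\<close>, which
  gives integrability of every summand.
\<close>

section \<open>Measurability on the space of triples and first moments of the rewards\<close>

lemma space_triple_space [simp]: "space triple_space = UNIV"
  by (simp add: triple_space_def space_pair_measure)

lemma measurable_Pair_triple_space [measurable]:
  "(\<lambda>r. (x, a, r)) \<in> borel \<rightarrow>\<^sub>M triple_space"
  unfolding triple_space_def by measurable

text \<open>The weight \<open>w\<close> is arbitrary, so measurability rests on countability:
  contexts and actions carry the discrete sigma-algebra, hence each of the two coordinates can be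
  frozen in turn, leaving a constant times \<open>h\<close>.\<close>

lemma borel_measurable_weighted_reward [measurable]:
  fixes w :: "'x::countable \<Rightarrow> 'a::finite \<Rightarrow> real" and h :: "real \<Rightarrow> real"
  assumes [measurable]: "h \<in> borel_measurable borel"
  shows "(\<lambda>(x, a, r). w x a * h r) \<in> borel_measurable triple_space"
proof -
  have fst [measurable]: "fst \<in> triple_space \<rightarrow>\<^sub>M (count_space UNIV :: 'x measure)"
    and snd [measurable]: "(\<lambda>z. fst (snd z)) \<in> triple_space \<rightarrow>\<^sub>M (count_space UNIV :: 'a measure)"
    and [measurable]: "(\<lambda>z. snd (snd z)) \<in> (triple_space :: ('x \<times> 'a \<times> real) measure) \<rightarrow>\<^sub>M borel"
    unfolding triple_space_def by measurable
  have "(\<lambda>z. w x (fst (snd z)) * h (snd (snd z)))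
          \<in> borel_measurable (triple_space :: ('x \<times> 'a \<times> real) measure)" for x
    by (rule measurable_compose_countable[OF _ snd]) measurable
  from measurable_compose_countable[OF this fst] show ?thesis
    by (simp add: case_prod_beta')
qed

lemma reward_model_prob_space: "reward_model D \<Longrightarrow> prob_space (D x a)"
  and reward_model_sets: "reward_model D \<Longrightarrow> sets (D x a) = sets borel"
  by (simp_all add: reward_model_def)

text \<open>The inequality |r| \<le> 1 + r^2 turns the second-moment bound into a first-moment
  bound. The same \<open>C\<close> serves all contexts and actions, which later makes averages over
  infinitely many contexts integrable.\<close>

lemma reward_model_abs_bounded:
  assumes "reward_model D"
  obtains C where "0 \<le> C" "\<And>x a. integrable (D x a) (\<lambda>r. r)" "\<And>x a. (\<integral>r. \<bar>r\<bar> \<partial>D x a) \<le> C"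
proof -
  obtain B where B: "\<And>x a. (\<integral>\<^sup>+ r. ennreal (r\<^sup>2) \<partial>D x a) \<le> ennreal B"
    using assms unfolding reward_model_def by blast
  \<comment> \<open>\<open>B\<close> may be negative, in which case \<open>ennreal B\<close> is 0;
    the absolute value keeps \<open>C\<close> nonnegative and the bound valid.\<close>
  define C where "C = 1 + \<bar>B\<bar>"
  have *: "(\<integral>\<^sup>+ r. ennreal \<bar>r\<bar> \<partial>D x a) \<le> ennreal C" for x a
  proof -
    interpret prob_space "D x a"
      using assms by (rule reward_model_prob_space)
    have [measurable_cong, simp]: "sets (D x a) = sets borel"
      using assms by (rule reward_model_sets)
    have "\<bar>r\<bar> \<le> 1 + r\<^sup>2" for r :: real
      using self_le_power[of "\<bar>r\<bar>" 2] by (cases "1 \<le> \<bar>r\<bar>") (auto simp: add_increasing add_increasing2)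
    then have "(\<integral>\<^sup>+ r. ennreal \<bar>r\<bar> \<partial>D x a) \<le> (\<integral>\<^sup>+ r. 1 + ennreal (r\<^sup>2) \<partial>D x a)"
      by (intro nn_integral_mono) (simp flip: ennreal_1 ennreal_plus)
    also have "\<dots> = 1 + (\<integral>\<^sup>+ r. ennreal (r\<^sup>2) \<partial>D x a)"
      by (subst nn_integral_add) (simp_all add: emeasure_space_1)
    also have "\<dots> \<le> 1 + ennreal \<bar>B\<bar>"
      using B[of x a] by (intro add_mono order_refl) (simp add: order_trans[OF _ ennreal_leI])
    finally show ?thesis
      by (simp add: C_def)
  qed
  show thesis
  proof
    show C: "0 \<le> C"
      by (simp add: C_def)
    fix x a
    have "(\<lambda>r. r) \<in> borel_measurable (D x a)"
      by (simp cong: measurable_cong_sets add: reward_model_sets[OF assms])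
    then show "integrable (D x a) (\<lambda>r. r)"
      using *[of x a] by (intro integrableI_bounded) (auto simp: le_less_trans)
    show "(\<integral>r. \<bar>r\<bar> \<partial>D x a) \<le> C"
      using C *[of x a] by (rule integral_real_bounded)
  qed
qed

section \<open>Integration against the law of one triple\<close>

lemma reward_kernel_in_space:
  assumes "reward_model D"
  shows "distr (D x a) triple_space (\<lambda>r. (x, a, r)) \<in> space (subprob_algebra triple_space)"
proof -
  interpret prob_space "D x a"
    using assms by (rule reward_model_prob_space)
  have "(\<lambda>r. (x, a, r)) \<in> D x a \<rightarrow>\<^sub>M triple_space"
    by (simp cong: measurable_cong_sets add: reward_model_sets[OF assms])
  then show ?thesis
    by (simp add: space_subprob_algebra prob_space_imp_subprob_space prob_space_distr)
qed

lemma action_reward_kernel_in_space: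
  assumes "reward_model D"
  shows "measure_pmf (p x) \<bind> (\<lambda>a. distr (D x a) triple_space (\<lambda>r. (x, a, r)))
           \<in> space (subprob_algebra triple_space)"
  using reward_kernel_in_space[OF assms]
  by (intro measure_pmf.bind_in_space) simp

lemma sets_sample_law: "sets (sample_law P D p) = sets triple_space"
  unfolding sample_law_def by (intro sets_bind) simp_all

text \<open>The two binds and the push-forward are unfolded one after the other. Measurability of
  the kernels reduces to the two membership facts above, because every map out of a discrete space
  is measurable.\<close>

lemma nn_integral_sample_law:
  assumes D: "reward_model D" and f [measurable]: "f \<in> borel_measurable triple_space"
  shows "(\<integral>\<^sup>+ z. f z \<partial>sample_law P D p) =
           (\<integral>\<^sup>+ x. \<integral>\<^sup>+ a. \<integral>\<^sup>+ r. f (x, a, r) \<partial>D x a \<partial>p x \<partial>P)"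
proof -
  have m: "(\<lambda>r. (x, a, r)) \<in> D x a \<rightarrow>\<^sub>M triple_space" for x a
    by (simp cong: measurable_cong_sets add: reward_model_sets[OF D])
  show ?thesis
    unfolding sample_law_def
    by (simp add: nn_integral_bind[OF f] nn_integral_distr[OF m] f
        action_reward_kernel_in_space[OF D] reward_kernel_in_space[OF D])
qed

text \<open>Only nonnegative functions: the Bochner version of the disintegration over a bind is available
  in the library for bounded integrands only, and rewards are unbounded.\<close>

lemma has_bochner_integral_sample_law_nonneg:
  assumes D: "reward_model D"
    and w: "\<And>x a. 0 \<le> w x a" "\<And>x a. pmf (p x) a * w x a \<le> K"
    and h [measurable]: "h \<in> borel_measurable borel" and h0: "\<And>r. 0 \<le> h r"
    and int: "\<And>x a. integrable (D x a) h" and C: "\<And>x a. (\<integral>r. h r \<partial>D x a) \<le> C" "0 \<le> C"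
  shows "has_bochner_integral (sample_law P D p) (\<lambda>(x, a, r). w x a * h r)
           (\<integral>x. (\<Sum>a\<in>UNIV. pmf (p x) a * w x a * (\<integral>r. h r \<partial>D x a)) \<partial>P)"
proof -
  define m where "m x a = (\<integral>r. h r \<partial>D x a)" for x a
  define g where "g x = (\<Sum>a\<in>UNIV. pmf (p x) a * w x a * m x a)" for x
  have m: "0 \<le> m x a" "m x a \<le> C" for x a
    using C h0 by (auto simp: m_def)
  have K: "0 \<le> K"
    using w(1) w(2) by (meson mult_nonneg_nonneg order_trans pmf_nonneg)
  have g0: "0 \<le> g x" for x
    using w m by (auto simp: g_def intro!: sum_nonneg)
  \<comment> \<open>The weight alone may be unbounded in \<open>x\<close>; its product with the
    sampling probability is at most \<open>K\<close>, and there are finitely many actions, so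
    \<open>g\<close> is bounded.\<close>
  have "g x \<le> (\<Sum>a\<in>(UNIV::'b set). K * C)" for x
    unfolding g_def using w m K by (intro sum_mono mult_mono) auto
  then have g_int: "integrable P g"
    using g0 by (intro measure_pmf.integrable_const_bound[where B = "\<Sum>a\<in>(UNIV::'b set). K * C"]) auto
  have "(\<integral>\<^sup>+ z. ennreal (case z of (x, a, r) \<Rightarrow> w x a * h r) \<partial>sample_law P D p)
      = (\<integral>\<^sup>+ x. \<integral>\<^sup>+ a. \<integral>\<^sup>+ r. ennreal (w x a * h r) \<partial>D x a \<partial>p x \<partial>P)"
    by (subst nn_integral_sample_law[OF D]) simp_all
  also have "\<dots> = (\<integral>\<^sup>+ x. \<integral>\<^sup>+ a. ennreal (w x a * m x a) \<partial>p x \<partial>P)"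
    using int w h0 by (intro nn_integral_cong) (subst nn_integral_eq_integral, auto simp: m_def)
  also have "\<dots> = (\<integral>\<^sup>+ x. ennreal (g x) \<partial>P)"
  proof (intro nn_integral_cong)
    fix x
    have "(\<integral>\<^sup>+ a. ennreal (w x a * m x a) \<partial>p x) = ennreal (\<integral>a. w x a * m x a \<partial>p x)"
      using w m by (intro nn_integral_eq_integral integrable_measure_pmf_finite) auto
    also have "(\<integral>a. w x a * m x a \<partial>p x) = g x"
      by (subst integral_measure_pmf_real[of UNIV]) (auto simp: g_def mult_ac)
    finally show "(\<integral>\<^sup>+ a. ennreal (w x a * m x a) \<partial>p x) = ennreal (g x)" .
  qed
  also have "\<dots> = ennreal (\<integral>x. g x \<partial>P)"
    using g_int g0 by (intro nn_integral_eq_integral) auto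
  finally have "(\<integral>\<^sup>+ z. ennreal (case z of (x, a, r) \<Rightarrow> w x a * h r) \<partial>sample_law P D p)
      = ennreal (\<integral>x. g x \<partial>P)" .
  moreover have "(\<lambda>(x, a, r). w x a * h r) \<in> borel_measurable (sample_law P D p)"
    by (simp cong: measurable_cong_sets add: sets_sample_law)
  ultimately show ?thesis
    using w h0 g0 unfolding g_def m_def
    by (intro has_bochner_integral_nn_integral) (auto intro!: integral_nonneg)
qed

text \<open>A finite sum of uniformly bounded terms is a bounded function of the context, hence
  integrable under a probability measure. In the uses below, \<open>c\<close> is a sampling
  probability, possibly times a weight, and \<open>m\<close> is a mean of the reward or of its
  positive or negative part.\<close>

lemma integrable_average:
  fixes m :: "'x \<Rightarrow> 'a::finite \<Rightarrow> real" and c :: "'x \<Rightarrow> 'a \<Rightarrow> real"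
  assumes "\<And>x a. \<bar>c x a\<bar> \<le> K" "\<And>x a. \<bar>m x a\<bar> \<le> C"
  shows "integrable (measure_pmf P) (\<lambda>x. \<Sum>a\<in>UNIV. c x a * m x a)"
proof -
  have "\<bar>\<Sum>a\<in>UNIV. c x a * m x a\<bar> \<le> (\<Sum>a\<in>(UNIV::'a set). K * C)" for x
    using assms by (intro order_trans[OF sum_abs] sum_mono)
      (auto simp: abs_mult intro!: mult_mono order_trans[OF abs_ge_zero])
  then show ?thesis
    by (intro measure_pmf.integrable_const_bound[where B = "\<Sum>a\<in>(UNIV::'a set). K * C"]) auto
qed

text \<open>Splitting the reward into positive and negative parts reduces this to the nonnegative
  case: both parts are dominated by |r|, so both inherit the bound \<open>C\<close>, and the two
  integrals are subtracted.\<close>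

lemma has_bochner_integral_sample_law:
  assumes D: "reward_model D"
    and w: "\<And>x a. 0 \<le> w x a" "\<And>x a. pmf (p x) a * w x a \<le> K"
  shows "has_bochner_integral (sample_law P D p) (\<lambda>(x, a, r). w x a * r)
           (\<integral>x. (\<Sum>a\<in>UNIV. pmf (p x) a * w x a * (\<integral>r. r \<partial>D x a)) \<partial>P)"
proof -
  obtain C where C: "0 \<le> C" "\<And>x a. integrable (D x a) (\<lambda>r. r)" "\<And>x a. (\<integral>r. \<bar>r\<bar> \<partial>D x a) \<le> C"
    using reward_model_abs_bounded[OF D] by blast
  define pos neg where "pos r = max 0 r" and "neg r = max 0 (- r)" for r :: real
  have [measurable]: "pos \<in> borel_measurable borel" "neg \<in> borel_measurable borel"
    unfolding pos_def[abs_def] neg_def[abs_def] by measurable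
  have int: "integrable (D x a) pos" "integrable (D x a) neg" for x a
    using C(2)[of x a] unfolding pos_def[abs_def] neg_def[abs_def] by auto
  have bound: "(\<integral>r. pos r \<partial>D x a) \<le> C" "(\<integral>r. neg r \<partial>D x a) \<le> C" for x a
    using int C(2)[of x a]
    by (auto intro!: order_trans[OF integral_mono C(3)] simp: pos_def neg_def)
  have nonneg: "0 \<le> pos r" "0 \<le> neg r" for r
    by (auto simp: pos_def neg_def)
  have bound_abs: "\<bar>\<integral>r. pos r \<partial>D x a\<bar> \<le> C" "\<bar>\<integral>r. neg r \<partial>D x a\<bar> \<le> C" for x a
    using bound nonneg by (simp_all add: integral_nonneg)
  have c: "\<bar>pmf (p x) a * w x a\<bar> \<le> K" for x a
    using w by simp
  have diff: "r = pos r - neg r" for r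
    by (simp add: pos_def neg_def)
  have "(\<integral>r. r \<partial>D x a) = (\<integral>r. pos r \<partial>D x a) - (\<integral>r. neg r \<partial>D x a)" for x a
    using int by (subst diff) simp
  \<comment> \<open>Separating the integral over contexts requires integrability of both averages,
    which \<open>integrable_average\<close> provides.\<close>
  then have eq: "(\<integral>x. (\<Sum>a\<in>UNIV. pmf (p x) a * w x a * (\<integral>r. r \<partial>D x a)) \<partial>P)
      = (\<integral>x. (\<Sum>a\<in>UNIV. pmf (p x) a * w x a * (\<integral>r. pos r \<partial>D x a)) \<partial>P)
        - (\<integral>x. (\<Sum>a\<in>UNIV. pmf (p x) a * w x a * (\<integral>r. neg r \<partial>D x a)) \<partial>P)"
    by (subst Bochner_Integration.integral_diff[symmetric])
       (auto intro!: integrable_average c bound_abs Bochner_Integration.integral_cong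
             simp: right_diff_distrib sum_subtractf)
  have "has_bochner_integral (sample_law P D p)
          (\<lambda>z. (case z of (x, a, r) \<Rightarrow> w x a * pos r) - (case z of (x, a, r) \<Rightarrow> w x a * neg r))
          (\<integral>x. (\<Sum>a\<in>UNIV. pmf (p x) a * w x a * (\<integral>r. r \<partial>D x a)) \<partial>P)"
    unfolding eq
    using D w int bound nonneg C(1)
    by (intro has_bochner_integral_diff
              has_bochner_integral_sample_law_nonneg[where w = w and p = p and K = K and C = C])
       simp_all
  moreover have "(\<lambda>z. (case z of (x, a, r) \<Rightarrow> w x a * pos r) - (case z of (x, a, r) \<Rightarrow> w x a * neg r))
      = (\<lambda>(x, a, r). w x a * r)"
    by (auto simp: diff[symmetric] simp flip: right_diff_distrib)
  ultimately show ?thesis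
    by simp
qed

text \<open>Mean rewards are uniformly bounded, so the average over actions is integrable in the
  context. Against a discrete law this is absolute summability, under which the infinite sum and the
  integral coincide.\<close>

lemma expected_reward_eq_expectation:
  assumes "reward_model D"
  shows "expected_reward P D p = (\<integral>x. (\<Sum>a\<in>UNIV. pmf (p x) a * (\<integral>r. r \<partial>D x a)) \<partial>P)"
proof -
  obtain C where C: "0 \<le> C" "\<And>x a. integrable (D x a) (\<lambda>r. r)" "\<And>x a. (\<integral>r. \<bar>r\<bar> \<partial>D x a) \<le> C"
    using reward_model_abs_bounded[OF assms] by blast
  let ?g = "\<lambda>x. \<Sum>a\<in>UNIV. pmf (p x) a * (\<integral>r. r \<partial>D x a)"
  have "\<bar>\<integral>r. r \<partial>D x a\<bar> \<le> C" for x a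
    by (rule order_trans[OF integral_abs_bound C(3)])
  then have "integrable (measure_pmf P) ?g"
    by (intro integrable_average[where K = 1 and C = C]) (auto simp: pmf_le_1)
  then have "Infinite_Set_Sum.abs_summable_on (\<lambda>x. pmf P x * ?g x) UNIV"
    unfolding measure_pmf_eq_density abs_summable_on_def
    by (subst (asm) integrable_density) auto
  then show ?thesis
    unfolding expected_reward_def pmf_expectation_eq_infsetsum
    by (subst infsetsum_infsum) (auto simp: sum_distrib_left mult_ac)
qed

section \<open>Support of the balanced policy\<close>

lemma balanced_pos_if_optimal:
  fixes p_tar p_log :: "'x \<Rightarrow> 'a::finite pmf"
  assumes \<alpha>: "0 < \<alpha>" "\<alpha> \<le> 1" and s: "\<And>a. sigma2hat x a > 0"
    and opt: "is_arg_min (objective \<alpha> p_tar p_log rhat sigma2hat x) feasible (pmf (p_aug x))"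
    and t: "0 < pmf (p_tar x) a"
  shows "0 < balanced \<alpha> p_log p_aug x a"
proof (rule ccontr)
  define c where "c b = (pmf (p_tar x) b)\<^sup>2 * ((rhat x b)\<^sup>2 + sigma2hat x b)" for b
  have c0: "0 \<le> c b" for b
    using s[of b] by (simp add: c_def)
  have den: "0 \<le> balanced \<alpha> p_log p_aug x b" for b
    using \<alpha> by (simp add: balanced_def)
  assume "\<not> 0 < balanced \<alpha> p_log p_aug x a"
  then have "balanced \<alpha> p_log p_aug x a = 0"
    using den[of a] by simp
  \<comment> \<open>Positivity of \<open>sigma2hat\<close> keeps the numerator positive even where
    \<open>rhat\<close> vanishes, so the summand is c/0 with c > 0 and not 0/0.\<close>
  moreover have "0 < c a"
    unfolding c_def using t s[of a] by (intro mult_pos_pos) (auto intro: add_nonneg_pos)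
  ultimately have "ereal (c a) / ereal (balanced \<alpha> p_log p_aug x a) = \<infinity>"
    by (simp add: ereal_pos_div_zero)
  then have inf: "objective \<alpha> p_tar p_log rhat sigma2hat x (pmf (p_aug x)) = \<infinity>"
    unfolding objective_def sum_Pinfty balanced_def c_def by (intro conjI bexI[of _ a]) simp_all
  \<comment> \<open>The uniform distribution is the competitor: as \<alpha> > 0, it makes every
    denominator positive, so its objective is a finite sum of finite terms.\<close>
  define u :: "'a \<Rightarrow> real" where "u b = 1 / real CARD('a)" for b
  have "feasible u"
    by (simp add: feasible_def u_def)
  moreover have "objective \<alpha> p_tar p_log rhat sigma2hat x u \<noteq> \<infinity>"
  proof -
    have "0 < (1 - \<alpha>) * pmf (p_log x) b + \<alpha> * u b" for b
      using \<alpha> by (intro add_nonneg_pos mult_nonneg_nonneg mult_pos_pos) (auto simp: u_def)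
    then have "(1 - \<alpha>) * pmf (p_log x) b + \<alpha> * u b \<noteq> 0" for b
      by (metis less_irrefl)
    then show ?thesis
      unfolding objective_def by (subst sum_Pinfty) auto
  qed
  ultimately show False
    using opt inf unfolding is_arg_min_def by auto
qed

section \<open>Unbiasedness of the balanced estimator\<close>

theorem theorem3p3:
  fixes P :: "'x::countable pmf"
    and D :: "'x \<Rightarrow> 'a::finite \<Rightarrow> real measure"
    and p_tar p_log p_aug :: "'x \<Rightarrow> 'a pmf"
    and n_log n_aug N :: nat
    and \<alpha> :: real
    and rhat sigma2hat :: "'x \<Rightarrow> 'a \<Rightarrow> real"
    and M :: "'w measure"
    and Z :: "nat \<Rightarrow> 'w \<Rightarrow> 'x \<times> 'a \<times> real"
  assumes rewards: "reward_model D"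
    and n_aug: "n_aug \<ge> 1"
    and N: "N = n_log + n_aug"
    and alpha: "\<alpha> = real n_aug / real N"
    and sigma2hat: "\<And>x a. sigma2hat x a > 0"
    and solution: "\<And>x. is_arg_min (objective \<alpha> p_tar p_log rhat sigma2hat x) feasible
                         (pmf (p_aug x))"
    and M: "prob_space M"
    and indep: "prob_space.indep_vars M (\<lambda>_. triple_space) Z {..<N}"
    and logged: "\<And>i. i < n_log \<Longrightarrow> distr M triple_space (Z i) = sample_law P D p_log"
    and augmented: "\<And>i. n_log \<le> i \<Longrightarrow> i < N \<Longrightarrow>
                      distr M triple_space (Z i) = sample_law P D p_aug"
  shows "integrable M (\<lambda>w. balanced_estimator N \<alpha> p_tar p_log p_aug (\<lambda>i. Z i w)) \<and>
         (\<integral>w. balanced_estimator N \<alpha> p_tar p_log p_aug (\<lambda>i. Z i w) \<partial>M) =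
           expected_reward P D p_tar"
proof -
  interpret prob_space M by (rule M)
  define \<beta> where "\<beta> = balanced \<alpha> p_log p_aug"
  define wt where "wt x a = pmf (p_tar x) a / \<beta> x a" for x a
  define f where "f = (\<lambda>(x, a, r). wt x a * r)"
  define E where "E p x = (\<Sum>a\<in>UNIV. pmf (p x) a * wt x a * (\<integral>r. r \<partial>D x a))" for p x
  have N0: "0 < real N"
    using n_aug N by simp
  have \<alpha>: "0 < \<alpha>" "\<alpha> \<le> 1"
    using n_aug N by (simp_all add: alpha)
  \<comment> \<open>Scaling by \<open>N\<close> replaces the mixture weights by the sample counts,
    the form in which the summands of the estimator recombine.\<close>
  have \<beta>: "real N * \<beta> x a = real n_log * pmf (p_log x) a + real n_aug * pmf (p_aug x) a" for x a
  proof -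
    have "real N * (1 - \<alpha>) = real n_log" "real N * \<alpha> = real n_aug"
      using N0 by (simp_all add: alpha N right_diff_distrib)
    then show ?thesis
      by (simp add: \<beta>_def balanced_def distrib_left flip: mult.assoc)
  qed
  have \<beta>0: "0 \<le> \<beta> x a" for x a
    using \<alpha> by (simp add: \<beta>_def balanced_def)
  have wt0: "0 \<le> wt x a" for x a
    using \<beta>0 by (simp add: wt_def)
  \<comment> \<open>Where the target policy vanishes, \<open>wt\<close> is 0 whatever the
    denominator is; elsewhere optimality makes the denominator positive, so it cancels.\<close>
  have \<beta>wt: "\<beta> x a * wt x a = pmf (p_tar x) a" for x a
  proof (cases "pmf (p_tar x) a = 0")
    case False
    then have "0 < pmf (p_tar x) a"
      by (simp add: order_less_le)
    then have "0 < \<beta> x a"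
      unfolding \<beta>_def using \<alpha> sigma2hat solution
      by (intro balanced_pos_if_optimal[where p_tar = p_tar and rhat = rhat and sigma2hat = sigma2hat])
    then show ?thesis
      by (simp add: wt_def)
  qed (simp add: wt_def)
  \<comment> \<open>A sampling policy dominated by \<open>N\<close> times the balanced one gives at
    most \<open>N\<close> times the target probability after cancellation, hence at most
    \<open>N\<close>.\<close>
  have bound: "pmf (p x) a * wt x a \<le> real N"
    if "\<And>x a. pmf (p x) a \<le> real N * \<beta> x a" for p x a
  proof -
    have "pmf (p x) a * wt x a \<le> real N * (\<beta> x a * wt x a)"
      using mult_right_mono[OF that wt0] by (simp add: mult.assoc)
    also have "\<dots> \<le> real N"
      using N0 by (simp add: \<beta>wt pmf_le_1)
    finally show ?thesis .
  qed
  \<comment> \<open>Measurability of each \<open>Z i\<close> is part of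
    \<open>indep_vars\<close>.\<close>
  have rv: "random_variable triple_space (Z i)" if "i < N" for i
    using indep that unfolding indep_vars_def by simp
  have f_meas: "f \<in> borel_measurable triple_space"
    unfolding f_def by (rule borel_measurable_weighted_reward) simp
  have transfer: "has_bochner_integral M (\<lambda>w. f (Z i w)) (\<integral>x. E p x \<partial>P)"
    if "i < N" "distr M triple_space (Z i) = sample_law P D p"
      "\<And>x a. pmf (p x) a \<le> real N * \<beta> x a" for i p
  proof -
    have "has_bochner_integral (distr M triple_space (Z i)) f (\<integral>x. E p x \<partial>P)"
      unfolding that(2) f_def E_def
      using rewards wt0 bound[OF that(3)]
      by (rule has_bochner_integral_sample_law[where K = "real N"])
    then show ?thesis
      using rv[OF that(1)] f_meas
      by (simp add: has_bochner_integral_iff integrable_distr_eq integral_distr)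
  qed
  \<comment> \<open>At least one logged sample is assumed: for \<open>n_log = 0\<close> the balanced
    policy is \<open>p_aug\<close> and need not dominate \<open>p_log\<close>.\<close>
  have log_le: "pmf (p_log x) a \<le> real N * \<beta> x a" if "0 < n_log" for x a
    unfolding \<beta> using mult_right_mono[of 1 "real n_log" "pmf (p_log x) a"] that
    by (simp add: add_increasing2)
  have aug_le: "pmf (p_aug x) a \<le> real N * \<beta> x a" for x a
    unfolding \<beta> using mult_right_mono[of 1 "real n_aug" "pmf (p_aug x) a"] n_aug
    by (simp add: add_increasing)
  \<comment> \<open>The expectation of the summand \<open>i\<close> depends only on the block of
    samples to which \<open>i\<close> belongs.\<close>
  let ?e = "\<lambda>i. if i < n_log then (\<integral>x. E p_log x \<partial>P) else (\<integral>x. E p_aug x \<partial>P)"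
  have each: "has_bochner_integral M (\<lambda>w. f (Z i w)) (?e i)" if "i < N" for i
    using transfer[OF that logged log_le] transfer[OF that augmented aug_le] that by auto
  have est: "balanced_estimator N \<alpha> p_tar p_log p_aug (\<lambda>i. Z i w) = 1 / real N * (\<Sum>i<N. f (Z i w))"
    for w
    by (simp add: balanced_estimator_def f_def wt_def \<beta>_def)
  have "{..<N} = {..<n_log} \<union> {n_log..<N}" "{..<n_log} \<inter> {n_log..<N} = {}"
    using N by auto
  then have "(\<Sum>i<N. ?e i) = (\<Sum>i<n_log. ?e i) + (\<Sum>i=n_log..<N. ?e i)"
    by (simp add: sum.union_disjoint del: sum.If_cases)
  then have sum_e: "(\<Sum>i<N. ?e i) = real n_log * (\<integral>x. E p_log x \<partial>P) + real n_aug * (\<integral>x. E p_aug x \<partial>P)"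
    by (simp add: N)
  obtain C where C: "0 \<le> C" "\<And>x a. integrable (D x a) (\<lambda>r. r)" "\<And>x a. (\<integral>r. \<bar>r\<bar> \<partial>D x a) \<le> C"
    using reward_model_abs_bounded[OF rewards] by blast
  have m: "\<bar>\<integral>r. r \<partial>D x a\<bar> \<le> C" for x a
    by (rule order_trans[OF integral_abs_bound C(3)])
  have E_int: "integrable P (E p)" if "\<And>x a. pmf (p x) a \<le> real N * \<beta> x a" for p
    unfolding E_def[abs_def] using bound[OF that] wt0 m
    by (intro integrable_average[where K = "real N" and C = C]) auto
  have E_log: "integrable P (\<lambda>x. real n_log * E p_log x)"
    using E_int[OF log_le] by (cases "n_log = 0") auto
  have "(\<Sum>i<N. ?e i) = (\<integral>x. real n_log * E p_log x + real n_aug * E p_aug x \<partial>P)"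
    unfolding sum_e using E_log E_int[OF aug_le] by simp
  \<comment> \<open>For each context, the count-weighted sampling policies add up to
    \<open>N\<close> times the balanced policy, which cancels against \<open>wt\<close> and leaves
    the target policy.\<close>
  also have "\<dots> = (\<integral>x. real N * (\<Sum>a\<in>UNIV. pmf (p_tar x) a * (\<integral>r. r \<partial>D x a)) \<partial>P)"
  proof (intro Bochner_Integration.integral_cong refl)
    fix x
    have "real n_log * E p_log x + real n_aug * E p_aug x
        = (\<Sum>a\<in>UNIV. (real N * \<beta> x a) * wt x a * (\<integral>r. r \<partial>D x a))"
      unfolding \<beta> E_def by (simp add: sum_distrib_left sum.distrib algebra_simps)
    also have "\<dots> = real N * (\<Sum>a\<in>UNIV. pmf (p_tar x) a * (\<integral>r. r \<partial>D x a))"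
      by (simp add: sum_distrib_left mult.assoc flip: \<beta>wt)
    finally show "real n_log * E p_log x + real n_aug * E p_aug x
        = real N * (\<Sum>a\<in>UNIV. pmf (p_tar x) a * (\<integral>r. r \<partial>D x a))" .
  qed
  also have "\<dots> = real N * expected_reward P D p_tar"
    by (simp add: expected_reward_eq_expectation[OF rewards])
  finally have "1 / real N * (\<Sum>i<N. ?e i) = expected_reward P D p_tar"
    using N0 by simp
  moreover have "has_bochner_integral M (\<lambda>w. 1 / real N * (\<Sum>i<N. f (Z i w))) (1 / real N * (\<Sum>i<N. ?e i))"
    using each by (intro has_bochner_integral_mult_right has_bochner_integral_sum) auto
  ultimately show ?thesis
    by (simp add: est has_bochner_integral_iff)
qed

end
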